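(* Let $d\ge2$. There exists a constant $C_d>0$, depending only on $d$, such that for all $\lambda>0$, all $y\in\mathbb R^d$ and all $r\ge 0$, $$C_P(\lambda,y,r)\ \ge\ \frac{C_d}{\lambda}\left(1+\frac{r\sqrt\lambda}{\max(|y|\sqrt\lambda,\,1)}\right).$$
   Context: For $d\ge2$, $\lambda>0$, $y\in\mathbb R^d$, $r\ge0$, let $\mu_{\lambda,r}$ be the probability measure $\mu_{\lambda,r}(dx)=Z^{-1}\mathbf 1_{|x-y|>r}\,e^{-\lambda|x|^2}\,dx$ on $\mathbb R^d$, where $|\cdot|$ is the Euclidean norm and $Z$ the normalizing constant. $C_P(\lambda,y,r)$ is its Poincaré constant: the smallest $C$ such that $\mathrm{Var}_{\mu_{\lambda,r}}(f)\le C\int|\nabla f|^2\,d\mu_{\lambda,r}$ for all smooth $f:\mathbb R^d\to\mathbb R$ (with $f,|\nabla f|\in L^2(\mu_{\lambda,r})$). *)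

theory Defs
  imports "HOL-Probability.Probability"
begin

definition partial_deriv :: "'n::finite \<Rightarrow> (real ^ 'n \<Rightarrow> real) \<Rightarrow> real ^ 'n \<Rightarrow> real" where
  "partial_deriv i f x = frechet_derivative f (at x) (axis i 1)"

definition gradient :: "(real ^ 'n::finite \<Rightarrow> real) \<Rightarrow> real ^ 'n \<Rightarrow> real ^ 'n" where
  "gradient f x = (\<chi> i. partial_deriv i f x)"

primrec Ck :: "nat \<Rightarrow> (real ^ 'n::finite \<Rightarrow> real) \<Rightarrow> bool" where
  "Ck 0 f \<longleftrightarrow> continuous_on UNIV f"
| "Ck (Suc k) f \<longleftrightarrow> f differentiable_on UNIV \<and> (\<forall>i. Ck k (partial_deriv i f))"

definition smooth :: "(real ^ 'n::finite \<Rightarrow> real) \<Rightarrow> bool" where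
  "smooth f \<longleftrightarrow> (\<forall>k. Ck k f)"

definition weight :: "real \<Rightarrow> real ^ 'n::finite \<Rightarrow> real \<Rightarrow> real ^ 'n \<Rightarrow> real" where
  "weight lam y r x = indicator {x. norm (x - y) > r} x * exp (- lam * (norm x)\<^sup>2)"

definition gauss_outside_ball :: "real \<Rightarrow> real ^ 'n::finite \<Rightarrow> real \<Rightarrow> (real ^ 'n) measure" where
  "gauss_outside_ball lam y r =
     density lborel (\<lambda>x. ennreal (weight lam y r x / (\<integral>z. weight lam y r z \<partial>lborel)))"

definition poincare_inequality :: "(real ^ 'n::finite) measure \<Rightarrow> real \<Rightarrow> bool" where
  "poincare_inequality \<mu> C \<longleftrightarrow>
     (\<forall>f. smooth f
        \<and> integrable \<mu> (\<lambda>x. (f x)\<^sup>2)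
        \<and> integrable \<mu> (\<lambda>x. (norm (gradient f x))\<^sup>2)
        \<longrightarrow> prob_space.variance \<mu> f \<le> C * (\<integral>x. (norm (gradient f x))\<^sup>2 \<partial>\<mu>))"

(* Extended real: the value is \<infinity> if no finite constant is admissible. *)
definition poincare_constant :: "real \<Rightarrow> real ^ 'n::finite \<Rightarrow> real \<Rightarrow> ereal" where
  "poincare_constant lam y r = Inf (ereal ` {C. poincare_inequality (gauss_outside_ball lam y r) C})"

end

theory Submission
  imports Defs
begin

text \<open>
  Let \<open>e\<close> be a unit vector with \<open>y = - |y| e\<close> and write \<open>W\<close> for the weight, \<open>Z = \<integral> W\<close>,
  \<open>p = e \<bullet> (x - y)\<close> and \<open>m = max |y| (1 / sqrt lam)\<close>. A linear function \<open>q = u \<bullet> x\<close> with \<open>u\<close> orthogonal to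
  \<open>y\<close> has mean 0 by reflection symmetry and constant gradient, so every admissible \<open>C\<close> satisfies
  \<open>\<integral> q\<^sup>2 W \<le> C |u|\<^sup>2 Z\<close>. It remains to bound \<open>\<integral> q\<^sup>2 W\<close> from below.

  Moving \<open>x\<close> by \<open>u / sqrt lam\<close> in the direction that increases \<open>|q|\<close> never enters the ball and, where
  \<open>|q| \<le> 1 / sqrt lam\<close>, costs at most a factor \<open>exp 3\<close> in \<open>W\<close>; hence \<open>Z \<le> (1 + 2 exp 3) lam \<integral> q\<^sup>2 W\<close>,
  which settles the case \<open>r \<le> m\<close>.

  Let \<open>r \<ge> m\<close>. Up to half of its mass, \<open>W\<close> lives on \<open>r < |x - y| \<le> K r\<close> with \<open>K\<close> depending only on the
  dimension, as the dilation by \<open>1/2\<close> about \<open>y\<close> shows. Reflections about \<open>y\<close> in the directions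
  \<open>\<sigma> e \<plusminus> \<tau> u\<close> with \<open>\<sigma>\<^sup>2 = 1 / (4 lam m r)\<close> preserve the ball, turn \<open>2 \<sigma> \<tau> p\<close> into a part of \<open>q\<close>, and on this
  region cost at most a factor \<open>exp K\<close>. So \<open>\<integral> p\<^sup>2 W\<close> over the region is at most a multiple of
  \<open>lam m r \<integral> q\<^sup>2 W\<close>. Since \<open>p\<^sup>2 + (|x - y|\<^sup>2 - p\<^sup>2) > r\<^sup>2\<close> there, and \<open>|x - y|\<^sup>2 - p\<^sup>2\<close> is a sum of squares of
  such functions \<open>q\<close>, one gets \<open>C \<ge> const * r / (lam m)\<close>.
\<close>

section \<open>Integrability of Gaussian functions\<close>

text \<open>The function factors over the coordinates, and each factor is a multiple of a normal
  density with variance \<open>1 / (2 * c)\<close>.\<close>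

lemma integrable_exp_neg_norm_square:
  fixes c :: real
  assumes "c > 0"
  shows "integrable lborel (\<lambda>x::'a::euclidean_space. exp (- c * (norm x)\<^sup>2))"
proof -
  define \<sigma> where "\<sigma> = sqrt (1 / (2 * c))"
  have \<sigma>: "\<sigma> > 0" "\<sigma>\<^sup>2 = 1 / (2 * c)"
    using assms by (auto simp: \<sigma>_def)
  have eq: "exp (- c * t\<^sup>2) = sqrt (2 * pi * \<sigma>\<^sup>2) * normal_density 0 \<sigma> t" for t
  proof -
    have "sqrt (2 * pi * \<sigma>\<^sup>2) > 0"
      using \<sigma>(1) by auto
    moreover have "- (t - 0)\<^sup>2 / (2 * \<sigma>\<^sup>2) = - c * t\<^sup>2"
      using assms by (simp add: \<sigma>(2))
    ultimately show ?thesis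
      using \<sigma>(1) unfolding normal_density_def by simp
  qed
  have int1: "integrable lborel (\<lambda>t::real. exp (- c * t\<^sup>2))"
    unfolding eq using \<sigma>(1) by (intro integrable_mult_right integrable_normal_density)
  have "exp (- c * (norm x)\<^sup>2) = (\<Prod>b\<in>Basis. exp (- c * (x \<bullet> b)\<^sup>2))" for x :: 'a
    unfolding exp_sum[OF finite_Basis, symmetric]
    by (simp add: euclidean_inner[of x x] power2_norm_eq_inner sum_negf sum_distrib_left)
      (simp add: power2_eq_square)
  then have "(\<integral>\<^sup>+(x::'a). ennreal (exp (- c * (norm x)\<^sup>2)) \<partial>lborel)
      = (\<integral>\<^sup>+(x::'a). (\<Prod>b\<in>Basis. ennreal (exp (- c * (x \<bullet> b)\<^sup>2))) \<partial>lborel)"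
    by (simp add: prod_ennreal)
  also have "\<dots> = (\<Prod>b\<in>(Basis::'a set). \<integral>\<^sup>+t. ennreal (exp (- c * t\<^sup>2)) \<partial>lborel)"
    by (rule nn_integral_lborel_prod) auto
  also have "\<dots> < \<infinity>"
    using int1 by (simp add: real_integrable_def less_top power_less_top_ennreal)
  finally show ?thesis
    by (intro integrableI_bounded) auto
qed

lemma integrable_norm_square_exp_neg_norm_square:
  fixes c :: real
  assumes "c > 0"
  shows "integrable lborel (\<lambda>x::'a::euclidean_space. (norm x)\<^sup>2 * exp (- c * (norm x)\<^sup>2))"
proof (rule Bochner_Integration.integrable_bound)
  show "integrable lborel (\<lambda>x::'a. 2 / c * exp (- (c / 2) * (norm x)\<^sup>2))"
    using assms by (intro integrable_mult_right integrable_exp_neg_norm_square) auto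
  \<comment> \<open>Half of the exponential decay is spent on absorbing the factor
    \<open>t\<close>.\<close>
  have "t * exp (- c * t) \<le> 2 / c * exp (- (c / 2) * t)" for t :: real
  proof -
    have "c / 2 * t \<le> exp (c / 2 * t)"
      using exp_ge_add_one_self[of "c / 2 * t"] by linarith
    then have "t \<le> 2 / c * exp (c / 2 * t)"
      using assms by (simp add: field_simps)
    then have "t * exp (- c * t) \<le> (2 / c * exp (c / 2 * t)) * exp (- c * t)"
      by (intro mult_right_mono) auto
    also have "\<dots> = 2 / c * exp (c / 2 * t + - c * t)"
      by (simp only: exp_add mult.assoc)
    also have "c / 2 * t + - c * t = - (c / 2) * t"
      by (simp add: field_simps)
    finally show ?thesis .
  qed
  then show "AE x::'a in lborel. norm ((norm x)\<^sup>2 * exp (- c * (norm x)\<^sup>2))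
      \<le> norm (2 / c * exp (- (c / 2) * (norm x)\<^sup>2))"
    using assms by (intro AE_I2) auto
qed auto

section \<open>Reflections and changes of variables for Lebesgue measure\<close>

text \<open>For a unit vector \<open>w\<close> this is the reflection in the hyperplane through
  \<open>y\<close> with normal \<open>w\<close>.\<close>

definition reflect :: "real ^ 'n \<Rightarrow> real ^ 'n::finite \<Rightarrow> real ^ 'n \<Rightarrow> real ^ 'n" where
  "reflect y w x = x - (2 * (w \<bullet> (x - y))) *\<^sub>R w"

lemma borel_measurable_reflect [measurable]: "reflect y w \<in> borel_measurable borel"
  unfolding reflect_def[abs_def] by measurable

lemma lborel_distr_translation:
  fixes t :: "'a::euclidean_space"
  shows "distr lborel borel (\<lambda>x. t + x) = lborel"
  using lborel_affine[of 1 t] by (simp add: density_1)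

text \<open>
  The library theorems on volumes of linear images need a well-ordered index type. Instead,
  integrate \<open>indicator A (f x + z) * indicator (ball 0 1) z\<close> over \<open>x\<close> and \<open>z\<close> in both orders.
\<close>

lemma lborel_distr_orthogonal_transformation:
  fixes f :: "'a::euclidean_space \<Rightarrow> 'a"
  assumes f: "orthogonal_transformation f"
  shows "distr lborel borel f = lborel"
proof (rule measure_eqI)
  have lin: "linear f" and "surj f"
    using f by (auto simp: orthogonal_transformation_linear orthogonal_transformation_surj)
  then have f_meas [measurable]: "f \<in> borel_measurable borel"
    by (intro borel_measurable_continuous_onI linear_continuous_on linear_conv_bounded_linear[THEN iffD1])
  fix A :: "'a set"
  assume "A \<in> sets (distr lborel borel f)"
  then have A [measurable]: "A \<in> sets borel"
    by simp
  let ?B = "ball 0 1 :: 'a set"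
  have [measurable]: "?B \<in> sets borel"
    by simp
  have shift: "(\<integral>\<^sup>+x. h (t + x) \<partial>lborel) = (\<integral>\<^sup>+x. h x \<partial>lborel)"
    if [measurable]: "h \<in> borel_measurable borel" for h :: "'a \<Rightarrow> ennreal" and t
    by (subst (2) lborel_distr_translation[of t, symmetric]) (simp add: nn_integral_distr)
  have "emeasure (distr lborel borel f) A * emeasure lborel ?B
      = (\<integral>\<^sup>+z. (\<integral>\<^sup>+x. indicator A (f x) \<partial>lborel) * indicator ?B z \<partial>lborel)"
    by (subst nn_integral_cmult) (auto simp: nn_integral_distr simp flip: nn_integral_indicator)
  also have "\<dots> = (\<integral>\<^sup>+z. (\<integral>\<^sup>+x. indicator A (f x + z) * indicator ?B z \<partial>lborel) \<partial>lborel)"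
  proof (intro nn_integral_cong)
    fix z
    \<comment> \<open>By surjectivity the shift by \<open>z\<close> after \<open>f\<close> is a
      shift by \<open>t\<close> before \<open>f\<close>, and Lebesgue measure is invariant under the
      latter.\<close>
    obtain t where "z = f t"
      using \<open>surj f\<close> by (metis surjD)
    then have "f x + z = f (t + x)" for x
      using lin by (simp add: linear_add)
    then have "(\<integral>\<^sup>+x. indicator A (f x) \<partial>lborel) = (\<integral>\<^sup>+x. indicator A (f x + z) \<partial>lborel :: ennreal)"
      using shift[of "\<lambda>x. indicator A (f x)" t] by simp
    then show "(\<integral>\<^sup>+x. indicator A (f x) \<partial>lborel) * indicator ?B z
        = (\<integral>\<^sup>+x. indicator A (f x + z) * indicator ?B z \<partial>lborel)"
      by (simp add: nn_integral_multc)
  qed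
  also have "\<dots> = (\<integral>\<^sup>+x. (\<integral>\<^sup>+z. indicator A (f x + z) * indicator ?B z \<partial>lborel) \<partial>lborel)"
    by (rule lborel_pair.Fubini') measurable
  also have "\<dots> = (\<integral>\<^sup>+x. (\<integral>\<^sup>+z. indicator A z * indicator ?B (z - f x) \<partial>lborel) \<partial>lborel)"
  proof (rule nn_integral_cong)
    fix x
    show "(\<integral>\<^sup>+z. indicator A (f x + z) * indicator ?B z \<partial>lborel)
        = (\<integral>\<^sup>+z. indicator A z * indicator ?B (z - f x) \<partial>lborel)"
      using shift[of "\<lambda>z. indicator A z * indicator ?B (z - f x)" "f x"] by simp
  qed
  also have "\<dots> = (\<integral>\<^sup>+z. (\<integral>\<^sup>+x. indicator A z * indicator ?B (z - f x) \<partial>lborel) \<partial>lborel)"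
    by (rule lborel_pair.Fubini') measurable
  also have "\<dots> = (\<integral>\<^sup>+z. indicator A z * emeasure lborel ?B \<partial>lborel)"
  proof (intro nn_integral_cong)
    fix z
    obtain t where t: "z = f t"
      using \<open>surj f\<close> by (metis surjD)
    have "norm (z - f (t + x)) = norm x" for x
      using lin orthogonal_transformation_norm[OF f, of x] by (simp add: t linear_add)
    then have "indicator ?B (z - f (t + x)) = (indicator ?B x :: ennreal)" for x
      by (simp add: indicator_def)
    then have "(\<integral>\<^sup>+x. indicator ?B (z - f x) \<partial>lborel) = emeasure lborel ?B"
      using shift[of "\<lambda>x. indicator ?B (z - f x)" t] by simp
    then show "(\<integral>\<^sup>+x. indicator A z * indicator ?B (z - f x) \<partial>lborel)
        = indicator A z * emeasure lborel ?B"
      by (simp add: nn_integral_cmult)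
  qed
  also have "\<dots> = emeasure lborel A * emeasure lborel ?B"
    by (simp add: nn_integral_multc)
  finally have *: "emeasure (distr lborel borel f) A * emeasure lborel ?B
      = emeasure lborel A * emeasure lborel ?B" .
  \<comment> \<open>The auxiliary factor has positive finite measure, so it can be
    cancelled.\<close>
  have "unit_ball_vol (real DIM('a)) > 0"
    by simp
  then have "emeasure lborel ?B \<noteq> 0"
    by (simp add: emeasure_ball del: unit_ball_vol_pos)
  moreover have "emeasure lborel ?B \<noteq> \<infinity>"
    using emeasure_lborel_ball_finite[of "0::'a" 1] by simp
  ultimately show "emeasure (distr lborel borel f) A = emeasure lborel A"
    using * by (simp add: mult.commute[of _ "emeasure lborel ?B"] ennreal_mult_cancel_left)
qed simp

text \<open>The reflection is an orthogonal map \<open>L\<close> followed by a translation, and both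
  preserve Lebesgue measure.\<close>

lemma lborel_distr_reflect:
  fixes y w :: "real ^ 'n::finite"
  assumes w: "norm w = 1"
  shows "distr lborel borel (reflect y w) = lborel"
proof -
  define L where "L v = v - (2 * (w \<bullet> v)) *\<^sub>R w" for v
  have lin: "linear L"
    unfolding L_def by (auto intro!: linearI simp: inner_simps algebra_simps scaleR_add_left)
  have "w \<bullet> w = 1"
    using w by (simp add: norm_eq_1)
  then have "L v \<bullet> L z = v \<bullet> z" for v z
    unfolding L_def by (simp add: inner_simps inner_commute)
  with lin have L: "orthogonal_transformation L"
    by (simp add: orthogonal_transformation_def)
  have [measurable]: "L \<in> borel_measurable borel"
    unfolding L_def[abs_def] by measurable
  have "reflect y w = (\<lambda>x. (2 * (w \<bullet> y)) *\<^sub>R w + x) \<circ> L"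
    by (auto simp: reflect_def L_def inner_simps algebra_simps)
  then have "distr lborel borel (reflect y w)
      = distr (distr lborel borel L) borel (\<lambda>x. (2 * (w \<bullet> y)) *\<^sub>R w + x)"
    by (simp add: distr_distr)
  then show ?thesis
    by (simp only: lborel_distr_orthogonal_transformation[OF L] lborel_distr_translation)
qed

lemma measure_preserving_lborel:
  fixes T :: "'a::euclidean_space \<Rightarrow> 'a" and h :: "'a \<Rightarrow> real"
  assumes T: "distr lborel borel T = lborel" and [measurable]: "T \<in> borel_measurable borel"
    and h: "integrable lborel h"
  shows integrable_lborel_measure_preserving: "integrable lborel (\<lambda>x. h (T x))"
    and integral_lborel_measure_preserving: "(\<integral>x. h (T x) \<partial>lborel) = (\<integral>x. h x \<partial>lborel)"
proof -
  have [measurable]: "h \<in> borel_measurable borel"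
    using borel_measurable_integrable[OF h] by simp
  show "integrable lborel (\<lambda>x. h (T x))"
    using h integrable_distr_eq[of T lborel borel h] by (simp add: T)
  show "(\<integral>x. h (T x) \<partial>lborel) = (\<integral>x. h x \<partial>lborel)"
    using integral_distr[of T lborel borel h] by (simp add: T)
qed

lemma dilation_lborel:
  fixes h :: "'a::euclidean_space \<Rightarrow> real" and c :: real and t :: 'a
  assumes h: "integrable lborel h" and c: "c \<noteq> 0"
  shows integrable_lborel_dilation: "integrable lborel (\<lambda>x. h (t + c *\<^sub>R x))"
    and integral_lborel_dilation:
      "\<bar>c\<bar> ^ DIM('a) * (\<integral>x. h (t + c *\<^sub>R x) \<partial>lborel) = (\<integral>x. h x \<partial>lborel)"
proof -
  have [measurable]: "h \<in> borel_measurable borel"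
    using borel_measurable_integrable[OF h] by simp
  note eq = lborel_affine[OF c, of t]
  have "integrable (distr lborel borel (\<lambda>x. t + c *\<^sub>R x)) (\<lambda>x. \<bar>c\<bar> ^ DIM('a) *\<^sub>R h x)"
    using h by (subst (asm) eq) (simp add: integrable_density)
  then show "integrable lborel (\<lambda>x. h (t + c *\<^sub>R x))"
    using c by (simp add: integrable_distr_eq)
  show "\<bar>c\<bar> ^ DIM('a) * (\<integral>x. h (t + c *\<^sub>R x) \<partial>lborel) = (\<integral>x. h x \<partial>lborel)"
    by (subst (2) eq) (simp add: integral_density integral_distr)
qed

section \<open>The weight: integrability, positivity, behaviour under reflections\<close>

lemma weight_nonneg: "0 \<le> weight lam y r x"
  by (simp add: weight_def)

lemma borel_measurable_weight [measurable]: "weight lam y r \<in> borel_measurable borel"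
  unfolding weight_def[abs_def] by measurable

text \<open>The functions paired with the weight in the estimates below grow at most quadratically,
  so their integrability reduces to Gaussian moments.\<close>

lemma integrable_weight_quadratic:
  fixes y :: "real ^ 'n::finite" and h :: "real ^ 'n \<Rightarrow> real"
  assumes lam: "lam > 0" and [measurable]: "h \<in> borel_measurable borel"
    and h: "\<And>x. \<bar>h x\<bar> \<le> a + b * (norm x)\<^sup>2"
  shows "integrable lborel (\<lambda>x. h x * weight lam y r x)"
proof (rule Bochner_Integration.integrable_bound)
  let ?E = "\<lambda>x::real ^ 'n. exp (- lam * (norm x)\<^sup>2)"
  show "integrable lborel (\<lambda>x. a * ?E x + b * ((norm x)\<^sup>2 * ?E x))"
    by (intro Bochner_Integration.integrable_add integrable_mult_right integrable_exp_neg_norm_square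
        integrable_norm_square_exp_neg_norm_square lam)
  have "norm (h x * weight lam y r x) \<le> norm (a * ?E x + b * ((norm x)\<^sup>2 * ?E x))" for x
  proof -
    have "norm (h x * weight lam y r x) \<le> (a + b * (norm x)\<^sup>2) * ?E x"
      unfolding weight_def norm_mult
      using h[of x] by (intro mult_mono) (auto simp: indicator_def)
    then show ?thesis
      by (simp add: algebra_simps)
  qed
  then show "AE x in lborel. norm (h x * weight lam y r x)
      \<le> norm (a * ?E x + b * ((norm x)\<^sup>2 * ?E x))"
    by (intro AE_I2)
qed measurable

lemma integrable_weight:
  "lam > 0 \<Longrightarrow> integrable lborel (weight lam y r :: real ^ 'n::finite \<Rightarrow> real)"
  using integrable_weight_quadratic[of lam "\<lambda>_. 1" 1 0 y r] by simp

lemma inner_square_le: "(u \<bullet> x)\<^sup>2 \<le> (norm u)\<^sup>2 * (norm x)\<^sup>2"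
  using Cauchy_Schwarz_ineq[of u x] by (simp add: power2_norm_eq_inner)

lemma integrable_weight_inner_square:
  fixes y u :: "real ^ 'n::finite"
  assumes "lam > 0"
  shows "integrable lborel (\<lambda>x. (u \<bullet> x)\<^sup>2 * weight lam y r x)"
  using assms by (rule integrable_weight_quadratic[where a = 0 and b = "(norm u)\<^sup>2"])
    (auto simp: inner_square_le)

text \<open>A vanishing integral would make the exterior of the ball, which is open and nonempty, a
  null set.\<close>

lemma integral_weight_pos:
  fixes y :: "real ^ 'n::finite"
  assumes lam: "lam > 0"
  shows "(\<integral>x. weight lam y r x \<partial>lborel) > 0"
proof -
  have "(\<integral>x. weight lam y r x \<partial>lborel) \<noteq> 0"
  proof
    assume "(\<integral>x. weight lam y r x \<partial>lborel) = 0"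
    then have "AE x in lborel. weight lam y r x = 0"
      using integral_nonneg_eq_0_iff_AE[OF integrable_weight[OF lam, of y r]] by (simp add: weight_nonneg)
    then have "AE x in lborel. x \<notin> {x. norm (x - y) > r}"
      by (rule AE_mp) (auto simp: weight_def)
    moreover have "open {x. norm (x - y) > r}"
      by (intro open_Collect_less continuous_intros)
    ultimately have "{x. norm (x - y) > r} = {}"
      using AE_iff_null_sets[of "{x. norm (x - y) > r}" lborel] open_not_negligible
      by (metis (no_types, lifting) borel_open negligible_iff_null_sets null_sets_completionI sets_lborel)
    \<comment> \<open>The absolute value makes the witness valid for either sign of
      \<open>r\<close>.\<close>
    moreover have "norm ((y + (\<bar>r\<bar> + 1) *\<^sub>R axis undefined 1) - y) > r"
      by simp
    ultimately show False
      by blast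
  qed
  moreover have "(\<integral>x. weight lam y r x \<partial>lborel) \<ge> 0"
    by (simp add: weight_nonneg)
  ultimately show ?thesis by simp
qed

lemma norm_reflect_diff:
  assumes "norm w = 1"
  shows "norm (reflect y w x - y) = norm (x - y)"
proof -
  have "w \<bullet> w = 1"
    using assms by (simp add: norm_eq_1)
  then have "(reflect y w x - y) \<bullet> (reflect y w x - y) = (x - y) \<bullet> (x - y)"
    unfolding reflect_def by (simp add: inner_simps inner_commute algebra_simps)
  then show ?thesis
    by (simp add: norm_eq_sqrt_inner)
qed

text \<open>The distance to \<open>y\<close> is preserved, so only the Gaussian factor changes: the
  reflection lowers the squared norm of \<open>x\<close> by
  \<open>4 * (w \<bullet> (x - y)) * (w \<bullet> y)\<close>.\<close>

lemma weight_reflect: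
  assumes "norm w = 1"
  shows "weight lam y r (reflect y w x) = weight lam y r x * exp (4 * lam * (w \<bullet> (x - y)) * (w \<bullet> y))"
proof -
  have "w \<bullet> w = 1"
    using assms by (simp add: norm_eq_1)
  then have "(norm (reflect y w x))\<^sup>2 = (norm x)\<^sup>2 - 4 * (w \<bullet> (x - y)) * (w \<bullet> y)"
    unfolding reflect_def power2_norm_eq_inner by (simp add: inner_simps inner_commute algebra_simps)
  then have "- lam * (norm (reflect y w x))\<^sup>2
      = - lam * (norm x)\<^sup>2 + 4 * lam * (w \<bullet> (x - y)) * (w \<bullet> y)"
    by (simp only:) (simp add: algebra_simps)
  then show ?thesis
    using norm_reflect_diff[OF assms, of y x] by (simp add: weight_def indicator_def mult_exp_exp)
qed

section \<open>The normalized measure and linear test functions\<close>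

lemma integral_gauss_outside_ball:
  fixes f :: "real ^ 'n::finite \<Rightarrow> real"
  assumes [measurable]: "f \<in> borel_measurable borel"
  shows "(\<integral>x. f x \<partial>gauss_outside_ball lam y r)
    = (\<integral>x. f x * weight lam y r x \<partial>lborel) / (\<integral>x. weight lam y r x \<partial>lborel)"
proof -
  have "(\<integral>x. f x \<partial>gauss_outside_ball lam y r)
      = (\<integral>x. weight lam y r x / (\<integral>z. weight lam y r z \<partial>lborel) * f x \<partial>lborel)"
    unfolding gauss_outside_ball_def
    by (subst integral_density) (auto simp: weight_nonneg integral_nonneg_AE)
  then show ?thesis
    by (simp add: mult.commute)
qed

lemma integrable_gauss_outside_ball:
  fixes f :: "real ^ 'n::finite \<Rightarrow> real"
  assumes [measurable]: "f \<in> borel_measurable borel"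
    and "integrable lborel (\<lambda>x. f x * weight lam y r x)"
  shows "integrable (gauss_outside_ball lam y r) f"
  unfolding gauss_outside_ball_def
  using assms(2) by (subst integrable_density) (auto simp: weight_nonneg integral_nonneg_AE mult.commute)

lemma partial_deriv_const: "partial_deriv i (\<lambda>_. c) = (\<lambda>_. 0)"
  by (simp add: partial_deriv_def fun_eq_iff)

lemma partial_deriv_inner: "partial_deriv i (\<lambda>x. u \<bullet> x) = (\<lambda>_. u $ i)"
proof -
  have "frechet_derivative ((\<bullet>) u) (at x) = (\<bullet>) u" for x
    by (rule frechet_derivative_at[symmetric])
      (intro bounded_linear_imp_has_derivative bounded_linear_inner_right)
  then show ?thesis
    by (simp add: partial_deriv_def fun_eq_iff inner_axis)
qed

lemma Ck_const: "Ck k (\<lambda>_. c)"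
  by (induction k arbitrary: c) (auto simp: partial_deriv_const)

lemma smooth_inner: "smooth (\<lambda>x. u \<bullet> x)"
proof -
  have "Ck k (\<lambda>x. u \<bullet> x)" for k
    by (cases k) (auto simp: partial_deriv_inner Ck_const intro!: continuous_intros
        bounded_linear_imp_differentiable_on bounded_linear_inner_right)
  then show ?thesis
    by (simp add: smooth_def)
qed

lemma gradient_inner: "gradient (\<lambda>x. u \<bullet> x) x = u"
  by (simp add: gradient_def partial_deriv_inner)

text \<open>Reflection in the direction of \<open>u\<close> fixes the weight, because that direction
  is orthogonal to \<open>y\<close>, and flips the sign of \<open>u \<bullet> x\<close>.\<close>

lemma integral_weight_inner_orthogonal:
  fixes y u :: "real ^ 'n::finite"
  assumes lam: "lam > 0" and u: "u \<bullet> y = 0"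
  shows "(\<integral>x. (u \<bullet> x) * weight lam y r x \<partial>lborel) = 0"
proof (cases "u = 0")
  case False
  define w where "w = u /\<^sub>R norm u"
  have w: "norm w = 1" "w \<bullet> y = 0"
    using False u by (auto simp: w_def)
  have "integrable lborel (\<lambda>x. (u \<bullet> x) * weight lam y r x)"
  proof (rule integrable_weight_quadratic[OF lam])
    fix x
    have "\<bar>u \<bullet> x\<bar> \<le> norm u * norm x"
      by (rule Cauchy_Schwarz_ineq2)
    also have "norm x \<le> 1 + (norm x)\<^sup>2"
      using sum_power2_ge_zero[of "norm x - 1" "0"] norm_ge_zero[of x] by (simp add: power2_diff del: norm_ge_zero)
    then have "norm u * norm x \<le> norm u * (1 + (norm x)\<^sup>2)"
      by (intro mult_left_mono) auto
    finally show "\<bar>u \<bullet> x\<bar> \<le> norm u + norm u * (norm x)\<^sup>2"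
      by (simp add: algebra_simps)
  qed auto
  then have "(\<integral>x. (u \<bullet> reflect y w x) * weight lam y r (reflect y w x) \<partial>lborel)
      = (\<integral>x. (u \<bullet> x) * weight lam y r x \<partial>lborel)"
    using lborel_distr_reflect[OF w(1), of y] borel_measurable_reflect
    by (intro integral_lborel_measure_preserving)
  moreover have "u \<bullet> reflect y w x = - (u \<bullet> x)" for x
    using False u w(2) by (simp add: reflect_def w_def inner_simps dot_square_norm power2_eq_square field_simps)
  moreover have "weight lam y r (reflect y w x) = weight lam y r x" for x
    using w by (simp add: weight_reflect)
  ultimately show ?thesis
    by simp
qed simp

text \<open>This is the sole application of the Poincare inequality. The mean vanishes, so the
  variance is the second moment, and the gradient is constantly \<open>u\<close>.\<close>

lemma poincare_inequality_inner_orthogonal: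
  fixes y u :: "real ^ 'n::finite"
  assumes lam: "lam > 0" and u: "u \<bullet> y = 0"
    and C: "poincare_inequality (gauss_outside_ball lam y r) C"
  shows "(\<integral>x. (u \<bullet> x)\<^sup>2 * weight lam y r x \<partial>lborel)
    \<le> C * (norm u)\<^sup>2 * (\<integral>x. weight lam y r x \<partial>lborel)"
proof -
  let ?\<mu> = "gauss_outside_ball lam y r" and ?Z = "\<integral>x. weight lam y r x \<partial>lborel"
  have Z: "?Z > 0"
    by (rule integral_weight_pos[OF lam])
  have "integrable ?\<mu> (\<lambda>x. (u \<bullet> x)\<^sup>2)"
    using integrable_weight_inner_square[OF lam, of u y r] by (intro integrable_gauss_outside_ball) auto
  moreover have "integrable ?\<mu> (\<lambda>x. (norm (gradient (\<lambda>x. u \<bullet> x) x))\<^sup>2)"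
    using integrable_weight[OF lam, of y r] by (intro integrable_gauss_outside_ball) (auto simp: gradient_inner)
  ultimately have "prob_space.variance ?\<mu> (\<lambda>x. u \<bullet> x)
      \<le> C * (\<integral>x. (norm (gradient (\<lambda>x. u \<bullet> x) x))\<^sup>2 \<partial>?\<mu>)"
    using C smooth_inner[of u] unfolding poincare_inequality_def by blast
  moreover have "(\<integral>x. u \<bullet> x \<partial>?\<mu>) = 0"
    by (simp add: integral_gauss_outside_ball integral_weight_inner_orthogonal[OF lam u])
  moreover have "(\<integral>x. (norm u)\<^sup>2 \<partial>?\<mu>) = (norm u)\<^sup>2"
    using Z by (subst integral_gauss_outside_ball) auto
  moreover have "(\<integral>x. (u \<bullet> x)\<^sup>2 \<partial>?\<mu>)
      = (\<integral>x. (u \<bullet> x)\<^sup>2 * weight lam y r x \<partial>lborel) / ?Z"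
    by (simp add: integral_gauss_outside_ball)
  ultimately have "(\<integral>x. (u \<bullet> x)\<^sup>2 * weight lam y r x \<partial>lborel) / ?Z \<le> C * (norm u)\<^sup>2"
    by (simp only: gradient_inner diff_zero)
  then show ?thesis
    using Z by (simp add: field_simps)
qed

section \<open>The bound of order \<open>1 / lam\<close>, by translations\<close>

text \<open>Outside the slab where \<open>\<bar>u \<bullet> x\<bar>\<close> is below
  \<open>1 / sqrt lam\<close> the factor \<open>lam * (u \<bullet> x)\<^sup>2\<close> is at least 1;
  each half of the slab is moved out of it by a translation. The exterior contributes 1 to the
  constant and each half contributes \<open>exp 3\<close>.\<close>

lemma integral_weight_le_translation:
  fixes y u :: "real ^ 'n::finite"
  assumes lam: "lam > 0" and u: "norm u = 1" "u \<bullet> y = 0"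
  shows "(\<integral>x. weight lam y r x \<partial>lborel)
    \<le> (1 + 2 * exp 3) * lam * (\<integral>x. (u \<bullet> x)\<^sup>2 * weight lam y r x \<partial>lborel)"
proof -
  define s where "s = 1 / sqrt lam"
  have s: "s > 0" "lam * s\<^sup>2 = 1"
    using lam by (auto simp: s_def power_divide)
  let ?W = "weight lam y r" and ?h = "\<lambda>x. (u \<bullet> x)\<^sup>2 * weight lam y r x"
  have uu: "u \<bullet> u = 1"
    using u(1) by (simp add: norm_eq_1)
  \<comment> \<open>Here \<open>k\<close> will be \<open>s\<close> or \<open>- s\<close>, with the
    sign that increases \<open>\<bar>u \<bullet> x\<bar>\<close>. The squared norm grows by at most
    \<open>2 * s\<^sup>2\<close> from the cross term plus \<open>s\<^sup>2\<close>; times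
    \<open>lam\<close> this is the 3 in the exponent.\<close>
  have shifted: "?W x \<le> exp 3 * lam * ?h (k *\<^sub>R u + x)"
    if k: "k\<^sup>2 = s\<^sup>2" "0 \<le> k * (u \<bullet> x)" "k * (u \<bullet> x) \<le> s\<^sup>2" for k x
  proof -
    have "(norm (k *\<^sub>R u + x))\<^sup>2 = (norm x)\<^sup>2 + 2 * (k * (u \<bullet> x)) + s\<^sup>2"
      using uu k(1) unfolding power2_norm_eq_inner
      by (simp add: inner_simps inner_commute power2_eq_square algebra_simps)
    also have "\<dots> \<le> (norm x)\<^sup>2 + 3 * s\<^sup>2"
      using k(3) by simp
    finally have "lam * (norm (k *\<^sub>R u + x))\<^sup>2 \<le> lam * ((norm x)\<^sup>2 + 3 * s\<^sup>2)"
      using lam by (intro mult_left_mono) auto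
    then have "- lam * (norm x)\<^sup>2 \<le> 3 + - lam * (norm (k *\<^sub>R u + x))\<^sup>2"
      using s(2) by (simp add: algebra_simps)
    then have exp_le: "exp (- lam * (norm x)\<^sup>2) \<le> exp 3 * exp (- lam * (norm (k *\<^sub>R u + x))\<^sup>2)"
      by (simp flip: exp_add)
    \<comment> \<open>Since \<open>u\<close> is orthogonal to \<open>y\<close>, the shift also
      increases the distance to \<open>y\<close>, so it cannot enter the ball.\<close>
    have "(norm (k *\<^sub>R u + x - y))\<^sup>2 = (norm (x - y))\<^sup>2 + 2 * (k * (u \<bullet> x)) + s\<^sup>2"
      using uu u(2) k(1) unfolding power2_norm_eq_inner
      by (simp add: inner_simps inner_commute power2_eq_square algebra_simps)
    then have "(norm (x - y))\<^sup>2 \<le> (norm (k *\<^sub>R u + x - y))\<^sup>2"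
      using k(2) by simp
    then have "norm (x - y) \<le> norm (k *\<^sub>R u + x - y)"
      by (rule power2_le_imp_le) simp
    then have W: "?W x \<le> exp 3 * ?W (k *\<^sub>R u + x)"
      using exp_le by (auto simp: weight_def indicator_def)
    have "(u \<bullet> (k *\<^sub>R u + x))\<^sup>2 = (u \<bullet> x)\<^sup>2 + 2 * (k * (u \<bullet> x)) + s\<^sup>2"
      using uu k(1) by (simp add: inner_simps power2_eq_square algebra_simps)
    then have "s\<^sup>2 \<le> (u \<bullet> (k *\<^sub>R u + x))\<^sup>2"
      using k(2) by simp
    then have "1 \<le> lam * (u \<bullet> (k *\<^sub>R u + x))\<^sup>2"
      using mult_left_mono[of "s\<^sup>2" _ lam] lam s(2) by fastforce
    then have "exp 3 * ?W (k *\<^sub>R u + x) * 1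
        \<le> exp 3 * ?W (k *\<^sub>R u + x) * (lam * (u \<bullet> (k *\<^sub>R u + x))\<^sup>2)"
      by (intro mult_left_mono) (auto simp: weight_nonneg)
    with W have "?W x \<le> exp 3 * ?W (k *\<^sub>R u + x) * (lam * (u \<bullet> (k *\<^sub>R u + x))\<^sup>2)"
      unfolding mult_1_right by (rule order_trans)
    then show ?thesis
      by (simp only: mult_ac)
  qed
  have pointwise: "?W x \<le> lam * ?h x + exp 3 * lam * ?h (s *\<^sub>R u + x) + exp 3 * lam * ?h ((- s) *\<^sub>R u + x)"
    for x
  proof -
    have nonneg: "0 \<le> ?h z" for z
      by (simp add: weight_nonneg)
    consider "s \<le> \<bar>u \<bullet> x\<bar>" | "0 \<le> u \<bullet> x" "u \<bullet> x \<le> s" | "u \<bullet> x \<le> 0" "- s \<le> u \<bullet> x"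
      by linarith
    then show ?thesis
    proof cases
      case 1
      then have "s\<^sup>2 \<le> (u \<bullet> x)\<^sup>2"
        using s(1) by (simp add: abs_le_square_iff[symmetric])
      then have "1 \<le> lam * (u \<bullet> x)\<^sup>2"
        using mult_left_mono[of "s\<^sup>2" _ lam] lam s(2) by fastforce
      then have "1 * ?W x \<le> lam * (u \<bullet> x)\<^sup>2 * ?W x"
        by (intro mult_right_mono) (auto simp: weight_nonneg)
      moreover have "0 \<le> exp 3 * lam * ?h (s *\<^sub>R u + x)" "0 \<le> exp 3 * lam * ?h ((- s) *\<^sub>R u + x)"
        using lam nonneg by auto
      ultimately show ?thesis
        by (simp only: mult.assoc mult_1_left)
    next
      case 2
      then have "?W x \<le> exp 3 * lam * ?h (s *\<^sub>R u + x)"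
        using s(1) by (intro shifted) (auto simp: power2_eq_square)
      moreover have "0 \<le> lam * ?h x" "0 \<le> exp 3 * lam * ?h ((- s) *\<^sub>R u + x)"
        using lam nonneg by auto
      ultimately show ?thesis
        by linarith
    next
      case 3
      then have "?W x \<le> exp 3 * lam * ?h ((- s) *\<^sub>R u + x)"
        using s(1) mult_left_mono[of "- (u \<bullet> x)" s s]
        by (intro shifted) (auto simp: power2_eq_square mult_nonneg_nonpos)
      moreover have "0 \<le> lam * ?h x" "0 \<le> exp 3 * lam * ?h (s *\<^sub>R u + x)"
        using lam nonneg by auto
      ultimately show ?thesis
        by linarith
    qed
  qed
  note h = integrable_weight_inner_square[OF lam, of u y r]
  have shift: "integrable lborel (\<lambda>x. ?h (t + x))" "(\<integral>x. ?h (t + x) \<partial>lborel) = (\<integral>x. ?h x \<partial>lborel)" for t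
    using h by (auto intro!: measure_preserving_lborel[OF lborel_distr_translation])
  have "(\<integral>x. ?W x \<partial>lborel) \<le> (\<integral>x. lam * ?h x + exp 3 * lam * ?h (s *\<^sub>R u + x)
      + exp 3 * lam * ?h ((- s) *\<^sub>R u + x) \<partial>lborel)"
    by (intro integral_mono pointwise integrable_weight[OF lam] Bochner_Integration.integrable_add
        integrable_mult_right h shift)
  also have "\<dots> = lam * (\<integral>x. ?h x \<partial>lborel) + exp 3 * lam * (\<integral>x. ?h x \<partial>lborel)
      + exp 3 * lam * (\<integral>x. ?h x \<partial>lborel)"
    using h shift(1)[of "s *\<^sub>R u"] shift(1)[of "(- s) *\<^sub>R u"]
    by (simp only: Bochner_Integration.integral_add integral_mult_right_zero shift(2)
        Bochner_Integration.integrable_add integrable_mult_right)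
  finally show ?thesis
    by (simp add: algebra_simps)
qed

section \<open>Estimates for large radius: reflections, tail, and their combination\<close>

text \<open>A reflection about \<open>y\<close> in a direction mixing \<open>e\<close> and
  \<open>u\<close> gives \<open>u \<bullet> x\<close> a part proportional to
  \<open>e \<bullet> (x - y)\<close>. The exponential on the left bounds from below the factor
  gained by the weight, once the sign of the \<open>u\<close> component is chosen well.\<close>

lemma integral_weight_reflections_le:
  fixes y e u :: "real ^ 'n::finite"
  assumes lam: "lam > 0" and e: "norm e = 1" "y = - (norm y *\<^sub>R e)"
    and u: "norm u = 1" "u \<bullet> e = 0" and st: "\<sigma>\<^sup>2 + \<tau>\<^sup>2 = 1"
  shows "4 * \<sigma>\<^sup>2 * \<tau>\<^sup>2 * (\<integral>x. (e \<bullet> (x - y))\<^sup>2 * exp (- (4 * lam * norm y * \<sigma>\<^sup>2 * \<bar>e \<bullet> (x - y)\<bar>))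
      * weight lam y r x \<partial>lborel)
    \<le> 6 * (\<integral>x. (u \<bullet> x)\<^sup>2 * weight lam y r x \<partial>lborel)"
proof -
  let ?W = "weight lam y r" and ?h = "\<lambda>x. (u \<bullet> x)\<^sup>2 * weight lam y r x"
  define p where "p x = e \<bullet> (x - y)" for x
  define D where "D x = exp (- (4 * lam * norm y * \<sigma>\<^sup>2 * \<bar>p x\<bar>))" for x
  define w where "w k = \<sigma> *\<^sub>R e - k *\<^sub>R u" for k
  have inners: "e \<bullet> e = 1" "u \<bullet> u = 1" "e \<bullet> u = 0" "u \<bullet> y = 0" "e \<bullet> y = - norm y"
  proof -
    show "e \<bullet> e = 1" "u \<bullet> u = 1" "e \<bullet> u = 0"
      using e(1) u by (auto simp: norm_eq_1 inner_commute)
    then show "u \<bullet> y = 0" "e \<bullet> y = - norm y"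
      using u(2) by (subst e(2); simp)+
  qed
  have w: "norm (w k) = 1" if "k\<^sup>2 = \<tau>\<^sup>2" for k
    using st that inners by (simp add: w_def norm_eq_1 inner_simps inner_commute power2_eq_square)
  have reflected: "4 * \<sigma>\<^sup>2 * \<tau>\<^sup>2 * ((p x)\<^sup>2 * D x * ?W x) \<le> 2 * ?h (reflect y (w k) x) + 2 * ?h x"
    if k: "k\<^sup>2 = \<tau>\<^sup>2" "0 \<le> \<sigma> * k * (u \<bullet> x)" for k x
  proof -
    let ?R = "reflect y (w k) x"
    have wv: "w k \<bullet> (x - y) = \<sigma> * p x - k * (u \<bullet> x)" and wy: "w k \<bullet> y = - (\<sigma> * norm y)"
      using inners by (simp_all add: w_def p_def inner_simps algebra_simps)
    have "- (4 * lam * norm y * \<sigma>\<^sup>2 * \<bar>p x\<bar>) \<le> - (4 * lam * norm y * \<sigma>\<^sup>2 * p x)"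
      using lam by (intro le_imp_neg_le mult_left_mono) auto
    also have "\<dots> \<le> - (4 * lam * norm y * \<sigma>\<^sup>2 * p x) + 4 * lam * norm y * (\<sigma> * k * (u \<bullet> x))"
      using mult_nonneg_nonneg[OF _ k(2), of "4 * lam * norm y"] lam by simp
    also have "\<dots> = 4 * lam * (w k \<bullet> (x - y)) * (w k \<bullet> y)"
      unfolding wv wy by (simp add: power2_eq_square algebra_simps)
    finally have "D x \<le> exp (4 * lam * (w k \<bullet> (x - y)) * (w k \<bullet> y))"
      unfolding D_def by (simp only: exp_le_cancel_iff)
    then have "D x * ?W x \<le> exp (4 * lam * (w k \<bullet> (x - y)) * (w k \<bullet> y)) * ?W x"
      by (intro mult_right_mono weight_nonneg)
    then have DW: "D x * ?W x \<le> ?W ?R"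
      by (simp add: weight_reflect[OF w[OF k(1)]] mult.commute)
    have "D x \<le> 1"
      using lam by (simp add: D_def)
    then have DW': "D x * ?W x \<le> ?W x"
      using mult_right_mono[OF _ weight_nonneg, of "D x" 1 lam y r x] by simp
    have uR: "u \<bullet> ?R = 2 * \<sigma> * k * p x + (1 - 2 * k\<^sup>2) * (u \<bullet> x)"
      unfolding reflect_def wv using inners
      by (simp add: w_def inner_simps inner_commute power2_eq_square algebra_simps)
    have "k\<^sup>2 \<le> 1"
      using st k(1) zero_le_power2[of \<sigma>] by linarith
    then have "\<bar>1 - 2 * k\<^sup>2\<bar> \<le> 1"
      by (simp add: abs_le_iff)
    then have "(1 - 2 * k\<^sup>2)\<^sup>2 \<le> 1"
      by (simp add: abs_square_le_1)
    then have one: "((1 - 2 * k\<^sup>2) * (u \<bullet> x))\<^sup>2 \<le> (u \<bullet> x)\<^sup>2"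
      unfolding power_mult_distrib using mult_right_mono[of _ 1 "(u \<bullet> x)\<^sup>2"] by fastforce
    \<comment> \<open>The term with \<open>p x\<close> is isolated in \<open>uR\<close>, and a
      squared difference is at most twice the sum of the squares.\<close>
    have "4 * \<sigma>\<^sup>2 * \<tau>\<^sup>2 * (p x)\<^sup>2 = (u \<bullet> ?R - (1 - 2 * k\<^sup>2) * (u \<bullet> x))\<^sup>2"
      unfolding uR k(1)[symmetric] by (simp add: power_mult_distrib)
    also have "\<dots> \<le> 2 * (u \<bullet> ?R)\<^sup>2 + 2 * ((1 - 2 * k\<^sup>2) * (u \<bullet> x))\<^sup>2"
      using zero_le_power2[of "u \<bullet> ?R + (1 - 2 * k\<^sup>2) * (u \<bullet> x)"] by (simp add: power2_diff power2_sum)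
    also have "\<dots> \<le> 2 * (u \<bullet> ?R)\<^sup>2 + 2 * (u \<bullet> x)\<^sup>2"
      using one by simp
    finally have "4 * \<sigma>\<^sup>2 * \<tau>\<^sup>2 * (p x)\<^sup>2 * (D x * ?W x)
        \<le> (2 * (u \<bullet> ?R)\<^sup>2 + 2 * (u \<bullet> x)\<^sup>2) * (D x * ?W x)"
      by (intro mult_right_mono) (auto simp: D_def weight_nonneg)
    also have "\<dots> = 2 * ((u \<bullet> ?R)\<^sup>2 * (D x * ?W x)) + 2 * ((u \<bullet> x)\<^sup>2 * (D x * ?W x))"
      by (simp add: algebra_simps)
    also have "\<dots> \<le> 2 * ((u \<bullet> ?R)\<^sup>2 * ?W ?R) + 2 * ((u \<bullet> x)\<^sup>2 * ?W x)"
      using DW DW' by (intro add_mono mult_left_mono) auto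
    finally show ?thesis
      by (simp add: mult.assoc)
  qed
  \<comment> \<open>The admissible sign of \<open>k\<close> depends on \<open>x\<close>, so both
    reflections appear. Each of the three terms integrates to twice the same integral, which gives
    the 6.\<close>
  have pointwise: "4 * \<sigma>\<^sup>2 * \<tau>\<^sup>2 * ((p x)\<^sup>2 * D x * ?W x)
      \<le> 2 * ?h (reflect y (w \<tau>) x) + 2 * ?h (reflect y (w (- \<tau>)) x) + 2 * ?h x" for x
  proof (cases "0 \<le> \<sigma> * \<tau> * (u \<bullet> x)")
    case True
    moreover have "0 \<le> 2 * ?h (reflect y (w (- \<tau>)) x)"
      by (simp add: weight_nonneg)
    ultimately show ?thesis
      using reflected[of \<tau> x] by linarith
  next
    case False
    then have "0 \<le> \<sigma> * (- \<tau>) * (u \<bullet> x)"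
      by simp
    moreover have "0 \<le> 2 * ?h (reflect y (w \<tau>) x)"
      by (simp add: weight_nonneg)
    ultimately show ?thesis
      using reflected[of "- \<tau>" x, OF power2_minus] by linarith
  qed
  note h = integrable_weight_inner_square[OF lam, of u y r]
  have refl: "integrable lborel (\<lambda>x. ?h (reflect y (w k) x))"
    "(\<integral>x. ?h (reflect y (w k) x) \<partial>lborel) = (\<integral>x. ?h x \<partial>lborel)" if "k\<^sup>2 = \<tau>\<^sup>2" for k
    using h measure_preserving_lborel[OF lborel_distr_reflect[OF w[OF that]] borel_measurable_reflect]
    by blast+
  have [measurable]: "p \<in> borel_measurable borel" "D \<in> borel_measurable borel"
    unfolding p_def[abs_def] D_def[abs_def] by measurable
  have "integrable lborel (\<lambda>x. (p x)\<^sup>2 * D x * ?W x)"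
  proof (rule integrable_weight_quadratic[OF lam])
    fix x
    have "(p x)\<^sup>2 \<le> (norm (x - y))\<^sup>2"
      using inner_square_le[of e "x - y"] e(1) by (simp add: p_def)
    also have "\<dots> \<le> 2 * (norm x)\<^sup>2 + 2 * (norm y)\<^sup>2"
      using zero_le_power2[of "norm (x + y)"] unfolding power2_norm_eq_inner
      by (simp add: inner_simps inner_commute)
    moreover have "D x \<le> 1"
      using lam by (simp add: D_def)
    then have "(p x)\<^sup>2 * D x \<le> (p x)\<^sup>2 * 1"
      by (intro mult_left_mono) auto
    ultimately show "\<bar>(p x)\<^sup>2 * D x\<bar> \<le> 2 * (norm y)\<^sup>2 + 2 * (norm x)\<^sup>2"
      by (simp add: D_def)
  qed measurable
  then have "(\<integral>x. 4 * \<sigma>\<^sup>2 * \<tau>\<^sup>2 * ((p x)\<^sup>2 * D x * ?W x) \<partial>lborel)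
      \<le> (\<integral>x. 2 * ?h (reflect y (w \<tau>) x) + 2 * ?h (reflect y (w (- \<tau>)) x) + 2 * ?h x \<partial>lborel)"
    by (intro integral_mono pointwise Bochner_Integration.integrable_add
        integrable_mult_right h refl) auto
  also have "\<dots> = 2 * (\<integral>x. ?h x \<partial>lborel) + 2 * (\<integral>x. ?h x \<partial>lborel) + 2 * (\<integral>x. ?h x \<partial>lborel)"
    using h refl(1)[of \<tau>] refl(1)[of "- \<tau>"] refl(2)[of \<tau>] refl(2)[of "- \<tau>"]
    by (simp only: Bochner_Integration.integral_add integral_mult_right_zero
        Bochner_Integration.integrable_add integrable_mult_right power2_minus simp_thms)
  finally show ?thesis
    by (simp add: p_def D_def)
qed

text \<open>Dilation by \<open>1 / 2\<close> about \<open>y\<close> keeps the far region outside the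
  ball, as \<open>K\<close> is at least 2, and gains the stated exponential. Its Jacobian produces
  the power of 2.\<close>

lemma integral_weight_tail_le:
  fixes y :: "real ^ 'n::finite"
  assumes lam: "lam > 0" and r: "norm y \<le> r" and K: "K \<ge> 2"
  shows "(\<integral>x. indicator {x. K * r < norm (x - y)} x * weight lam y r x \<partial>lborel)
    \<le> 2 ^ CARD('n) * exp (- (lam * (K * r)\<^sup>2 / 4)) * (\<integral>x. weight lam y r x \<partial>lborel)"
proof -
  let ?W = "weight lam y r" and ?T = "\<lambda>x. (1 / 2) *\<^sub>R y + (1 / 2) *\<^sub>R x"
  have r0: "r \<ge> 0"
    using r norm_ge_zero[of y] by linarith
  have pointwise: "indicator {x. K * r < norm (x - y)} x * ?W x
      \<le> exp (- (lam * (K * r)\<^sup>2 / 4)) * ?W (?T x)" for x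
  proof (cases "K * r < norm (x - y)")
    case True
    define v where "v = x - y"
    have x: "x = y + v" and T: "?T x = y + (1 / 2) *\<^sub>R v"
      by (auto simp: v_def algebra_simps simp flip: scaleR_add_left)
    have v: "K * r < norm v" "2 * r < norm v"
      using True mult_right_mono[OF K r0] by (auto simp: v_def)
    \<comment> \<open>As \<open>norm y\<close> is at most half of \<open>norm v\<close>, the cross
      term costs at most \<open>1 / 2\<close> of the \<open>3 / 4\<close> available below, leaving
      the \<open>1 / 4\<close> in the exponent.\<close>
    have "\<bar>y \<bullet> v\<bar> \<le> norm y * norm v"
      by (rule Cauchy_Schwarz_ineq2)
    also have "\<dots> \<le> norm v / 2 * norm v"
      using v(2) r by (intro mult_right_mono) auto
    finally have "- ((norm v)\<^sup>2 / 2) \<le> y \<bullet> v"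
      by (simp add: power2_eq_square abs_le_iff)
    moreover have "(norm x)\<^sup>2 = (norm (?T x))\<^sup>2 + y \<bullet> v + 3 / 4 * (norm v)\<^sup>2"
      unfolding T unfolding x power2_norm_eq_inner
      by (simp add: inner_simps inner_commute power2_eq_square algebra_simps)
    moreover have "(K * r)\<^sup>2 \<le> (norm v)\<^sup>2"
      using v(1) K r0 by (intro power_mono) auto
    ultimately have "(K * r)\<^sup>2 / 4 + (norm (?T x))\<^sup>2 \<le> (norm x)\<^sup>2"
      by linarith
    then have "lam * ((K * r)\<^sup>2 / 4 + (norm (?T x))\<^sup>2) \<le> lam * (norm x)\<^sup>2"
      using lam by (intro mult_left_mono) auto
    then have "- lam * (norm x)\<^sup>2 \<le> - (lam * (K * r)\<^sup>2 / 4) + - lam * (norm (?T x))\<^sup>2"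
      by (simp add: algebra_simps)
    then have "exp (- lam * (norm x)\<^sup>2)
        \<le> exp (- (lam * (K * r)\<^sup>2 / 4)) * exp (- lam * (norm (?T x))\<^sup>2)"
      by (simp only: exp_le_cancel_iff flip: exp_add)
    moreover have "norm (?T x - y) > r"
      using v(2) unfolding T by simp
    ultimately show ?thesis
      by (auto simp: weight_def indicator_def)
  qed (simp add: weight_nonneg)
  note W = integrable_weight[OF lam, of y r]
  have "integrable lborel (\<lambda>x. indicator {x. K * r < norm (x - y)} x * ?W x)"
    by (rule integrable_weight_quadratic[OF lam, where a = 1 and b = 0]) (auto simp: indicator_def)
  then have "(\<integral>x. indicator {x. K * r < norm (x - y)} x * ?W x \<partial>lborel)
      \<le> (\<integral>x. exp (- (lam * (K * r)\<^sup>2 / 4)) * ?W (?T x) \<partial>lborel)"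
    by (intro integral_mono pointwise integrable_mult_right integrable_lborel_dilation W) auto
  also have "\<dots> = exp (- (lam * (K * r)\<^sup>2 / 4)) * (2 ^ CARD('n) * (\<integral>x. ?W x \<partial>lborel))"
    using integral_lborel_dilation[OF W, of "1 / 2" "(1 / 2) *\<^sub>R y"]
    by (simp add: power_divide field_simps)
  finally show ?thesis
    by (simp add: mult_ac)
qed

text \<open>This absorbs the Jacobian of the dilation and leaves at most half of the mass in the
  tail.\<close>

lemma two_power_exp_tail_le:
  "2 ^ n * exp (- ((real n + 1)\<^sup>2)) \<le> (1 / 2 :: real)"
proof -
  have "(2::real) ^ Suc n \<le> exp 1 ^ Suc n"
    using exp_ge_add_one_self[of "1::real"] by (intro power_mono) auto
  also have "\<dots> = exp (real n + 1)"
    by (simp add: exp_of_nat_mult[symmetric] exp_add)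
  also have "\<dots> \<le> exp ((real n + 1)\<^sup>2)"
    by (simp add: power2_eq_square algebra_simps)
  finally show ?thesis
    by (simp add: exp_minus field_simps)
qed

lemma integral_weight_le_far:
  fixes y e u :: "real ^ 'n::finite"
  assumes lam: "lam > 0" and e: "norm e = 1" "y = - (norm y *\<^sub>R e)"
    and u: "norm u = 1" "u \<bullet> e = 0" and m: "norm y \<le> m" "1 \<le> lam * m\<^sup>2" "m \<le> r" "m > 0"
  shows "r * (\<integral>x. weight lam y r x \<partial>lborel)
    \<le> 18 * exp (2 * real CARD('n) + 2) * lam * m
      * (\<integral>x. ((norm (x - y))\<^sup>2 - (e \<bullet> (x - y))\<^sup>2) * weight lam y r x \<partial>lborel)"
proof -
  let ?W = "weight lam y r"
  \<comment> \<open>With this \<open>K\<close> and \<open>lam * r\<^sup>2\<close> at least 1, the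
    tail exponent \<open>lam * (K * r)\<^sup>2 / 4\<close> is at least
    \<open>(real CARD('n) + 1)\<^sup>2\<close>.\<close>
  define K where "K = 2 * real CARD('n) + 2"
  \<comment> \<open>This value makes the exponent in \<open>D\<close> at most \<open>K\<close> in
    size on the shell up to \<open>K * r\<close>. Since \<open>lam * m * r\<close> is at least 1, it
    also keeps \<open>\<sigma>\<^sup>2\<close> below or at \<open>1 / 4\<close>.\<close>
  define \<sigma> where "\<sigma> = sqrt (1 / (4 * lam * m * r))"
  define \<tau> where "\<tau> = sqrt (1 - \<sigma>\<^sup>2)"
  define p where "p x = e \<bullet> (x - y)" for x
  define D where "D x = exp (- (4 * lam * norm y * \<sigma>\<^sup>2 * \<bar>p x\<bar>))" for x
  define Q where "Q x = (norm (x - y))\<^sup>2 - (p x)\<^sup>2" for x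
  let ?Z = "\<integral>x. ?W x \<partial>lborel" and ?I = "\<integral>x. Q x * ?W x \<partial>lborel"
  have K: "K \<ge> 2"
    by (simp add: K_def)
  have r: "r > 0"
    using m by linarith
  have mr: "1 \<le> lam * m * r"
  proof -
    have "lam * m * m \<le> lam * m * r"
      using m lam by (intro mult_left_mono) auto
    then show ?thesis
      using m(2) by (simp add: power2_eq_square mult.assoc)
  qed
  have \<sigma>: "\<sigma>\<^sup>2 = 1 / (4 * lam * m * r)"
    using lam m r by (simp add: \<sigma>_def)
  have "\<sigma>\<^sup>2 \<le> 1 / 4"
    unfolding \<sigma> using mr by (simp add: field_simps)
  then have \<tau>: "\<tau>\<^sup>2 = 1 - \<sigma>\<^sup>2" "3 / 4 \<le> \<tau>\<^sup>2"
    by (auto simp: \<tau>_def)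
  have [measurable]: "p \<in> borel_measurable borel" "D \<in> borel_measurable borel" "Q \<in> borel_measurable borel"
    unfolding p_def[abs_def] D_def[abs_def] Q_def[abs_def] by measurable
  have p_le: "(p x)\<^sup>2 \<le> (norm (x - y))\<^sup>2" for x
    using inner_square_le[of e "x - y"] e(1) by (simp add: p_def)
  have norm_le: "(norm (x - y))\<^sup>2 \<le> 2 * (norm y)\<^sup>2 + 2 * (norm x)\<^sup>2" for x
    using zero_le_power2[of "norm (x + y)"] unfolding power2_norm_eq_inner
    by (simp add: inner_simps inner_commute)
  have int_Q: "integrable lborel (\<lambda>x. Q x * ?W x)"
  proof (rule integrable_weight_quadratic[OF lam])
    show "\<bar>Q x\<bar> \<le> 2 * (norm y)\<^sup>2 + 2 * (norm x)\<^sup>2" for x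
      using p_le[of x] norm_le[of x] zero_le_power2[of "p x"] unfolding Q_def by linarith
  qed measurable
  have int_p: "integrable lborel (\<lambda>x. (p x)\<^sup>2 * D x * ?W x)"
  proof (rule integrable_weight_quadratic[OF lam])
    fix x
    have "D x \<le> 1"
      using lam by (simp add: D_def)
    then have "(p x)\<^sup>2 * D x \<le> (p x)\<^sup>2 * 1"
      by (intro mult_left_mono) auto
    then show "\<bar>(p x)\<^sup>2 * D x\<bar> \<le> 2 * (norm y)\<^sup>2 + 2 * (norm x)\<^sup>2"
      using p_le[of x] norm_le[of x] by (simp add: D_def)
  qed measurable
  let ?F = "indicator {x. K * r < norm (x - y)}"
  have int_tail: "integrable lborel (\<lambda>x. ?F x * ?W x)"
    by (rule integrable_weight_quadratic[OF lam, where a = 1 and b = 0]) (auto simp: indicator_def)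
  \<comment> \<open>The three terms stand for the tail, the transverse part of \<open>x - y\<close>,
    and its part along \<open>e\<close>, the last one weighted so that the reflection estimate
    applies.\<close>
  have pointwise: "r\<^sup>2 * ?W x \<le> r\<^sup>2 * (?F x * ?W x) + Q x * ?W x + exp K * ((p x)\<^sup>2 * D x * ?W x)" for x
  proof -
    have nonneg: "0 \<le> Q x * ?W x" "0 \<le> exp K * ((p x)\<^sup>2 * D x * ?W x)"
      using p_le[of x] by (auto simp: Q_def D_def weight_nonneg)
    consider "norm (x - y) \<le> r" | "K * r < norm (x - y)" | "r < norm (x - y)" "norm (x - y) \<le> K * r"
      by linarith
    then show ?thesis
    proof cases
      case 1
      then show ?thesis
        by (simp add: weight_def)
    next
      case 2
      then show ?thesis
        using nonneg by simp
    next
      case 3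
      have "\<bar>p x\<bar> \<le> K * r"
        using Cauchy_Schwarz_ineq2[of e "x - y"] e(1) 3(2) by (simp add: p_def)
      then have "4 * lam * norm y * \<sigma>\<^sup>2 * \<bar>p x\<bar> \<le> 4 * lam * m * \<sigma>\<^sup>2 * (K * r)"
        using lam m by (intro mult_mono) auto
      also have "\<dots> = K"
        using lam m r by (simp add: \<sigma>)
      finally have "exp (- K) \<le> D x"
        by (simp add: D_def)
      then have "exp K * exp (- K) \<le> exp K * D x"
        by (intro mult_left_mono) auto
      then have "1 \<le> exp K * D x"
        by (simp flip: exp_add)
      then have "(p x)\<^sup>2 * 1 \<le> (p x)\<^sup>2 * (exp K * D x)"
        by (intro mult_left_mono) auto
      moreover have "r\<^sup>2 \<le> (norm (x - y))\<^sup>2"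
        using 3(1) r by (intro power_mono) auto
      ultimately have "r\<^sup>2 \<le> Q x + exp K * ((p x)\<^sup>2 * D x)"
        by (simp add: Q_def algebra_simps)
      then have "r\<^sup>2 * ?W x \<le> (Q x + exp K * ((p x)\<^sup>2 * D x)) * ?W x"
        by (intro mult_right_mono weight_nonneg)
      moreover have "0 \<le> r\<^sup>2 * (?F x * ?W x)"
        by (simp add: weight_nonneg)
      ultimately show ?thesis
        by (simp add: algebra_simps)
    qed
  qed
  have "(\<integral>x. r\<^sup>2 * ?W x \<partial>lborel)
      \<le> (\<integral>x. r\<^sup>2 * (?F x * ?W x) + Q x * ?W x + exp K * ((p x)\<^sup>2 * D x * ?W x) \<partial>lborel)"
    by (intro integral_mono pointwise Bochner_Integration.integrable_add integrable_mult_right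
        int_tail int_Q int_p integrable_weight[OF lam])
  also have "\<dots> = r\<^sup>2 * (\<integral>x. ?F x * ?W x \<partial>lborel) + ?I
      + exp K * (\<integral>x. (p x)\<^sup>2 * D x * ?W x \<partial>lborel)"
    using int_tail int_Q int_p
    by (simp only: Bochner_Integration.integral_add integral_mult_right_zero
        Bochner_Integration.integrable_add integrable_mult_right)
  finally have main: "r\<^sup>2 * ?Z \<le> r\<^sup>2 * (\<integral>x. ?F x * ?W x \<partial>lborel) + ?I
      + exp K * (\<integral>x. (p x)\<^sup>2 * D x * ?W x \<partial>lborel)"
    by simp
  have Z: "0 \<le> ?Z"
    by (simp add: weight_nonneg)
  have tail: "(\<integral>x. ?F x * ?W x \<partial>lborel) \<le> 1 / 2 * ?Z"
  proof -
    have "lam * m * r \<le> lam * r * r"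
      using lam m r by (simp add: mult_right_mono)
    then have "1 \<le> lam * r\<^sup>2"
      using mr by (simp add: power2_eq_square mult.assoc)
    then have "(real CARD('n) + 1)\<^sup>2 * 1 \<le> (real CARD('n) + 1)\<^sup>2 * (lam * r\<^sup>2)"
      by (intro mult_left_mono) auto
    also have "\<dots> = lam * (K * r)\<^sup>2 / 4"
      by (simp add: K_def power2_eq_square field_simps)
    finally have "2 ^ CARD('n) * exp (- (lam * (K * r)\<^sup>2 / 4)) \<le> 2 ^ CARD('n) * exp (- ((real CARD('n) + 1)\<^sup>2))"
      by simp
    also have "\<dots> \<le> 1 / 2"
      by (rule two_power_exp_tail_le)
    finally have "2 ^ CARD('n) * exp (- (lam * (K * r)\<^sup>2 / 4)) * ?Z \<le> 1 / 2 * ?Z"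
      using Z by (rule mult_right_mono)
    moreover have "norm y \<le> r"
      using m by linarith
    ultimately show ?thesis
      using integral_weight_tail_le[OF lam _ K, of y r] by linarith
  qed
  have I_ge: "(\<integral>x. (u \<bullet> x)\<^sup>2 * ?W x \<partial>lborel) \<le> ?I"
  proof (rule integral_mono)
    have uy: "u \<bullet> y = 0"
      using u(2) by (subst e(2)) simp
    fix x
    have "e \<bullet> e = 1" "u \<bullet> u = 1" "e \<bullet> u = 0"
      using e(1) u by (auto simp: norm_eq_1 inner_commute)
    \<comment> \<open>The left side is the squared length of what remains of \<open>x - y\<close>
      after projecting off \<open>e\<close> and \<open>u\<close>.\<close>
    then have "(norm (x - y - p x *\<^sub>R e - (u \<bullet> x) *\<^sub>R u))\<^sup>2 = Q x - (u \<bullet> x)\<^sup>2"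
      unfolding Q_def p_def power2_norm_eq_inner using uy
      by (simp add: inner_simps inner_commute power2_eq_square algebra_simps)
    then have "(u \<bullet> x)\<^sup>2 \<le> Q x"
      using zero_le_power2[of "norm (x - y - p x *\<^sub>R e - (u \<bullet> x) *\<^sub>R u)"] by linarith
    then show "(u \<bullet> x)\<^sup>2 * ?W x \<le> Q x * ?W x"
      by (intro mult_right_mono weight_nonneg)
  qed (intro int_Q integrable_weight_inner_square[OF lam])+
  have I: "0 \<le> ?I"
    by (rule order_trans[OF _ I_ge]) (simp add: weight_nonneg)
  let ?P = "\<integral>x. (p x)\<^sup>2 * D x * ?W x \<partial>lborel"
  have P0: "0 \<le> ?P"
    by (simp add: D_def weight_nonneg)
  have "4 * \<sigma>\<^sup>2 * (3 / 4) * ?P \<le> 4 * \<sigma>\<^sup>2 * \<tau>\<^sup>2 * ?P"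
    using \<tau>(2) P0 by (intro mult_right_mono mult_left_mono) auto
  also have "\<dots> \<le> 6 * ?I"
    using integral_weight_reflections_le[OF lam e u, of \<sigma> \<tau> r] \<tau>(1) I_ge
    unfolding D_def p_def by linarith
  finally have "lam * m * r * (3 * \<sigma>\<^sup>2 * ?P) \<le> lam * m * r * (6 * ?I)"
    using mr by (intro mult_left_mono) auto
  moreover have "lam * m * r * (3 * \<sigma>\<^sup>2 * ?P) = 3 / 4 * ?P"
    using lam m r by (simp add: \<sigma>)
  ultimately have P: "?P \<le> 8 * (lam * m * r) * ?I"
    by simp
  \<comment> \<open>The bare \<open>?I\<close> is absorbed into the same multiple as the 8 from
    \<open>P\<close>, giving 9. Moving the tail, at most half of the left side, across doubles this
    to 18.\<close>
  have "1 * ?I \<le> (exp K * (lam * m * r)) * ?I"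
  proof (rule mult_right_mono)
    show "1 \<le> exp K * (lam * m * r)"
      using mult_mono[of 1 "exp K" 1 "lam * m * r"] mr K by simp
  qed (rule I)
  moreover have "exp K * ?P \<le> 8 * (exp K * (lam * m * r) * ?I)"
    using mult_left_mono[OF P, of "exp K"] by (simp add: mult_ac)
  moreover have "r\<^sup>2 * (\<integral>x. ?F x * ?W x \<partial>lborel) \<le> r\<^sup>2 * ?Z / 2"
    using mult_left_mono[OF tail, of "r\<^sup>2"] by simp
  ultimately have "r\<^sup>2 * ?Z / 2 \<le> 9 * (exp K * (lam * m * r) * ?I)"
    using main by linarith
  then have "r * (r * ?Z) \<le> r * (18 * exp K * lam * m * ?I)"
    by (simp add: power2_eq_square algebra_simps)
  then show ?thesis
    using r by (simp add: K_def p_def Q_def)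
qed

section \<open>Summation over transverse directions and the final bound\<close>

text \<open>The vectors \<open>f i\<close> are the projections of the standard basis onto the
  complement of \<open>e\<close>. The squares of \<open>f i \<bullet> x\<close> add up to the
  integrand, and the squared lengths of the \<open>f i\<close> add up to the trace
  \<open>CARD('n) - 1\<close> of the projection, so no orthonormal basis of the complement has to be
  chosen.\<close>

lemma integral_weight_transverse_le:
  fixes y e :: "real ^ 'n::finite"
  assumes lam: "lam > 0" and e: "norm e = 1" "y = - (norm y *\<^sub>R e)"
    and C: "poincare_inequality (gauss_outside_ball lam y r) C"
  shows "(\<integral>x. ((norm (x - y))\<^sup>2 - (e \<bullet> (x - y))\<^sup>2) * weight lam y r x \<partial>lborel)
    \<le> C * (CARD('n) - 1) * (\<integral>x. weight lam y r x \<partial>lborel)"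
proof -
  define f where "f i = axis i 1 - e $ i *\<^sub>R e" for i :: 'n
  have ee: "e \<bullet> e = 1"
    using e(1) by (simp add: norm_eq_1)
  have f_inner: "f i \<bullet> z = (z - (e \<bullet> z) *\<^sub>R e) $ i" for i z
    by (simp add: f_def inner_simps inner_axis' mult.commute)
  have fe: "f i \<bullet> e = 0" for i
    by (simp add: f_inner ee)
  from fe have fy: "f i \<bullet> y = 0" for i
    by (subst e(2)) simp
  have sum_f: "(\<Sum>i\<in>UNIV. (f i \<bullet> x)\<^sup>2) = (norm (x - y))\<^sup>2 - (e \<bullet> (x - y))\<^sup>2" for x
  proof -
    have "(\<Sum>i\<in>UNIV. (f i \<bullet> x)\<^sup>2) = (\<Sum>i\<in>UNIV. (f i \<bullet> (x - y))\<^sup>2)"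
      by (simp add: inner_diff_right fy)
    also have "\<dots> = (norm (x - y - (e \<bullet> (x - y)) *\<^sub>R e))\<^sup>2"
      unfolding f_inner power2_norm_eq_inner by (subst inner_vec_def) (simp add: power2_eq_square)
    also have "\<dots> = (norm (x - y))\<^sup>2 - (e \<bullet> (x - y))\<^sup>2"
      unfolding power2_norm_eq_inner using ee
      by (simp add: inner_diff_left[of "x - y"] inner_diff_right[of _ "x - y"] inner_commute power2_eq_square)
    finally show ?thesis .
  qed
  have "(\<Sum>i\<in>UNIV. (norm (f i))\<^sup>2) = (\<Sum>i\<in>UNIV. 1 - (e $ i)\<^sup>2)"
  proof (rule sum.cong)
    fix i
    have "f i \<bullet> f i = f i $ i"
      by (subst f_inner) (simp add: fe inner_commute[of e])
    then show "(norm (f i))\<^sup>2 = 1 - (e $ i)\<^sup>2"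
      unfolding power2_norm_eq_inner by (simp only: f_def) (simp add: power2_eq_square)
  qed simp
  also have "\<dots> = real CARD('n) - 1"
    using ee by (simp add: sum_subtractf inner_vec_def power2_eq_square)
  finally have card: "(\<Sum>i\<in>UNIV. (norm (f i))\<^sup>2) = real (CARD('n) - 1)"
    by (simp add: of_nat_diff)
  have "(\<integral>x. ((norm (x - y))\<^sup>2 - (e \<bullet> (x - y))\<^sup>2) * weight lam y r x \<partial>lborel)
      = (\<integral>x. (\<Sum>i\<in>UNIV. (f i \<bullet> x)\<^sup>2 * weight lam y r x) \<partial>lborel)"
    by (simp add: sum_f flip: sum_distrib_right)
  also have "\<dots> = (\<Sum>i\<in>UNIV. \<integral>x. (f i \<bullet> x)\<^sup>2 * weight lam y r x \<partial>lborel)"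
    by (intro Bochner_Integration.integral_sum integrable_weight_inner_square[OF lam])
  also have "\<dots> \<le> (\<Sum>i\<in>UNIV. C * (norm (f i))\<^sup>2 * (\<integral>x. weight lam y r x \<partial>lborel))"
    by (intro sum_mono poincare_inequality_inner_orthogonal lam fy C)
  also have "\<dots> = C * (CARD('n) - 1) * (\<integral>x. weight lam y r x \<partial>lborel)"
    by (simp add: card flip: sum_distrib_left sum_distrib_right)
  finally show ?thesis .
qed

lemma poincare_inequality_gauss_outside_ball_lower:
  fixes y :: "real ^ 'n::finite"
  assumes card: "CARD('n) \<ge> 2" and lam: "lam > 0"
    and C: "poincare_inequality (gauss_outside_ball lam y r) C"
  shows "1 / (4 * (1 + 2 * exp 3) + 36 * exp (2 * real CARD('n) + 2) * real CARD('n)) / lam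
    * (1 + r * sqrt lam / max (norm y * sqrt lam) 1) \<le> C"
proof -
  define a where "a = 1 + 2 * exp (3::real)"
  define b where "b = 18 * exp (2 * real CARD('n) + 2) * real CARD('n)"
  define m where "m = max (norm y) (1 / sqrt lam)"
  have ab: "a > 0" "b > 0"
    using card by (auto simp: a_def b_def intro: add_pos_pos)
  have m: "m > 0" "norm y \<le> m" "1 \<le> lam * m\<^sup>2"
  proof -
    show "m > 0" "norm y \<le> m"
      using lam by (auto simp: m_def less_max_iff_disj)
    have "(1 / sqrt lam)\<^sup>2 \<le> m\<^sup>2"
      using lam by (intro power_mono) (auto simp: m_def)
    then have "1 / lam \<le> m\<^sup>2"
      using lam by (simp add: power_divide)
    then show "1 \<le> lam * m\<^sup>2"
      using lam by (simp add: field_simps)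
  qed
  have "max (norm y * sqrt lam) 1 = m * sqrt lam"
    using lam by (simp add: m_def max_mult_distrib_right)
  then have ratio: "r * sqrt lam / max (norm y * sqrt lam) 1 = r / m"
    using lam by simp
  \<comment> \<open>For nonzero \<open>y\<close>, \<open>e\<close> points from \<open>y\<close>
    towards the origin; for \<open>y = 0\<close> any unit vector serves.\<close>
  obtain e :: "real ^ 'n" where e: "norm e = 1" "y = - (norm y *\<^sub>R e)"
  proof (cases "y = 0")
    case True
    then show ?thesis
      using that[of "axis undefined 1"] by simp
  next
    case False
    then show ?thesis
      using that[of "- (y /\<^sub>R norm y)"] by simp
  qed
  obtain u where u: "norm u = 1" "u \<bullet> e = 0"
  proof -
    \<comment> \<open>The dimension hypothesis provides a direction orthogonal to
      \<open>e\<close>.\<close>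
    obtain u where "u \<noteq> 0" "orthogonal e u"
      using orthogonal_to_vector_exists[of e] card by auto
    then show ?thesis
      using that[of "u /\<^sub>R norm u"] by (simp add: orthogonal_def inner_commute)
  qed
  let ?Z = "\<integral>x. weight lam y r x \<partial>lborel"
  have Z: "?Z > 0"
    by (rule integral_weight_pos[OF lam])
  have uy: "u \<bullet> y = 0"
    using u(2) by (subst e(2)) simp
  have "?Z \<le> a * lam * (\<integral>x. (u \<bullet> x)\<^sup>2 * weight lam y r x \<partial>lborel)"
    unfolding a_def by (rule integral_weight_le_translation[OF lam u(1) uy])
  also have "\<dots> \<le> a * lam * (C * (norm u)\<^sup>2 * ?Z)"
    using lam ab by (intro mult_left_mono poincare_inequality_inner_orthogonal[OF lam uy C]) auto
  finally have "1 * ?Z \<le> (a * lam * C) * ?Z"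
    using u(1) by (simp add: mult_ac)
  then have near: "1 \<le> a * lam * C"
    using Z by (simp only: mult_le_cancel_right_pos)
  then have C0: "C > 0"
    using ab lam by (smt (verit) mult_nonneg_nonpos mult_pos_pos)
  have "r / m \<le> (a + b) * lam * C"
  proof (cases "m \<le> r")
    case True
    let ?I = "\<integral>x. ((norm (x - y))\<^sup>2 - (e \<bullet> (x - y))\<^sup>2) * weight lam y r x \<partial>lborel"
    have "?I \<le> C * real (CARD('n) - 1) * ?Z"
      by (rule integral_weight_transverse_le[OF lam e C])
    also have "\<dots> \<le> C * real CARD('n) * ?Z"
      using C0 Z by (intro mult_right_mono mult_left_mono) auto
    finally have I: "?I \<le> C * real CARD('n) * ?Z" .
    have "r * ?Z \<le> 18 * exp (2 * real CARD('n) + 2) * lam * m * ?I"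
      by (rule integral_weight_le_far[OF lam e u m(2,3) True m(1)])
    also have "\<dots> \<le> 18 * exp (2 * real CARD('n) + 2) * lam * m * (C * real CARD('n) * ?Z)"
      using lam m by (intro mult_left_mono I) auto
    also have "\<dots> = (b * lam * C * m) * ?Z"
      by (simp add: b_def)
    finally have "r \<le> b * lam * C * m"
      using Z by (simp only: mult_le_cancel_right_pos)
    also have "\<dots> \<le> (a + b) * lam * C * m"
      using ab lam C0 m by (intro mult_right_mono) auto
    finally show ?thesis
      using m(1) by (simp add: field_simps)
  next
    case False
    \<comment> \<open>For \<open>r\<close> below \<open>m\<close> the translation bound
      \<open>near\<close> already suffices.\<close>
    then have "r / m \<le> 1"
      using m(1) by simp
    also have "\<dots> \<le> (a + b) * lam * C"
      using near ab lam C0 by (simp add: algebra_simps add_increasing2)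
    finally show ?thesis .
  qed
  \<comment> \<open>The bounds on 1 and on \<open>r / m\<close> add up to
    \<open>(2 * a + b) * lam * C\<close>; the further factor 2 is slack.\<close>
  moreover have "a * lam * C + (a + b) * lam * C \<le> 2 * (2 * a + b) * lam * C"
    using ab lam C0 by (simp add: algebra_simps)
  ultimately have "1 + r / m \<le> 2 * (2 * a + b) * lam * C"
    using near by linarith
  then have "(1 + r / m) / (2 * (2 * a + b) * lam) \<le> C"
    using ab lam by (subst pos_divide_le_eq) (auto simp: mult.commute)
  then have "1 / (2 * (2 * a + b)) / lam * (1 + r / m) \<le> C"
    by simp
  moreover have "2 * (2 * a + b) = 4 * (1 + 2 * exp 3) + 36 * exp (2 * real CARD('n) + 2) * real CARD('n)"
    by (simp add: a_def b_def)
  ultimately show ?thesis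
    unfolding ratio by (simp only:)
qed

theorem proposition8p8:
  assumes "CARD('n::finite) \<ge> 2"
  shows "\<exists>C\<^sub>d > (0::real). \<forall>(lam::real) (y :: real ^ 'n) (r::real). lam > 0 \<longrightarrow> r \<ge> 0 \<longrightarrow>
           poincare_constant lam y r
             \<ge> ereal (C\<^sub>d / lam * (1 + r * sqrt lam / max (norm y * sqrt lam) 1))"
proof (intro exI conjI allI impI)
  show "0 < 1 / (4 * (1 + 2 * exp 3) + 36 * exp (2 * real CARD('n) + 2) * real CARD('n))"
    by (simp add: add_pos_nonneg)
  show "ereal (1 / (4 * (1 + 2 * exp 3) + 36 * exp (2 * real CARD('n) + 2) * real CARD('n)) / lam
      * (1 + r * sqrt lam / max (norm y * sqrt lam) 1)) \<le> poincare_constant lam y r"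
    if "lam > 0" "r \<ge> 0" for lam r and y :: "real ^ 'n"
    \<comment> \<open>Bounding every admissible constant suffices: if there is none, the infimum is
      infinite.\<close>
    unfolding poincare_constant_def
    using poincare_inequality_gauss_outside_ball_lower[OF assms that(1)] by (auto intro!: Inf_greatest)
qed

end
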